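(* Assume that at most one job arrives in any given time slot (i.e. the $a_j$, $j\in J$, are pairwise distinct), that $C$ is non-decreasing and convex, and let $\beta\in[0,1]$. When the operator follows the baseline strategy, there is an optimal clique partition solving the attacker's problem with budget $|J^*|\le\beta n$ that contains a locally maximal clique, or a clique that can be made locally maximal by adding jobs from cliques of size $1$ only (that is, contains a clique $K$ such that for some slot $t$, $K\subseteq K^t$ and every job in $K^t\setminus K$ forms by itself a clique of size $1$ in the partition).
   Context: Total-energy model. Time is slotted with slots $1,\dots,T$; $[k,l]$ denotes the set of slots $\{k,\dots,l\}$. There are $n\ge1$ jobs $J=\{1,\dots,n\}$; job $j$ has demand $(a_j,d_j,e_j)$ with $a_j,d_j\in\{1,\dots,T\}$, $a_j\le d_j$, $e_j>0$ (arrival slot, deadline slot, total energy); its job interval is $[a_j,d_j]$. The cost function is $C:[0,\infty)\to[0,\infty)$. Baseline strategy: the operator serves each received demand entirely and immediately upon its arrival; for demands $(a'_i,d'_i,e'_i)$, $i\in J'$, the cost is $C_{base}(a',d',e')=\sum_{t\in\{0,\dots,T\}}C\big(\sum_{i\in J':a'_i=t}e'_i\big)$. Attacker's problem when the operator follows the baseline strategy: the attacker replaces each job $j$ by a finite collection $b_j$ of (sub)jobs $(a'_k,d'_k,e'_k)$, with $a'_k,d'_k$ positive integers, $e'_k\ge0$, $a_j\le a'_k\le d'_k\le d_j$, $\sum_ke'_k=e_j$; $J^*=\{j\in J:b_j\ne\{(a_j,d_j,e_j)\}\}$ is the set of modified jobs. The attacker maximizes $C_{base}$ of the forged demands subject to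 $|J^*|\le\beta n$; the optimal value is $C^2_{maxmin}(\beta)$. A clique of $J$ is a set of jobs whose job intervals pairwise intersect; a clique partition is a partition of $J$ into cliques. For a slot $t$, $K^t=\{j\in J:a_j\le t\le d_j\}$; a clique is locally maximal if it equals $K^t$ for some $t$. It suffices for the attacker to choose $J^*\subseteq J$ with $|J^*|\le\beta n$ and slots $t_j\in[a_j,d_j]$ for $j\in J^*$, forging $(a'_j,d'_j)=(t_j,t_j)$, and to leave other jobs unaltered (so $t_j:=a_j$ for $j\notin J^*$). An optimal clique partition is the partition of $J$ into the nonempty sets $\{j\in J:t_j=t\}$ for such a choice that attains $C^2_{maxmin}(\beta)$. *)

theory Defs
  imports "HOL-Analysis.Convex" "HOL-Library.Multiset" "HOL-Library.Disjoint_Sets"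
begin

text \<open>A demand is a triple of arrival slot, deadline slot and total energy.\<close>

type_synonym demand = "nat \<times> nat \<times> real"

definition total_energy :: "demand multiset \<Rightarrow> real" where
  "total_energy D = (\<Sum>(a', d', e')\<in>#D. e')"

definition base_cost :: "nat \<Rightarrow> (real \<Rightarrow> real) \<Rightarrow> demand multiset \<Rightarrow> real" where
  "base_cost T C D = (\<Sum>t\<in>{0..T}. C (total_energy (filter_mset (\<lambda>(a', d', e'). a' = t) D)))"

definition jobs :: "nat \<Rightarrow> nat set" where
  "jobs n = {1..n}"

definition job_interval :: "(nat \<Rightarrow> nat) \<Rightarrow> (nat \<Rightarrow> nat) \<Rightarrow> nat \<Rightarrow> nat set" where
  "job_interval a d j = {a j..d j}"

text \<open>An attack \<open>b\<close> replaces each job by a finite collection of subjobs. Collections are multisets,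
  since identical subjobs may occur repeatedly.\<close>

definition valid_attack ::
  "nat \<Rightarrow> (nat \<Rightarrow> nat) \<Rightarrow> (nat \<Rightarrow> nat) \<Rightarrow> (nat \<Rightarrow> real) \<Rightarrow> (nat \<Rightarrow> demand multiset) \<Rightarrow> bool" where
  "valid_attack n a d e b \<longleftrightarrow>
     (\<forall>j\<in>jobs n.
        (\<forall>(a', d', e')\<in>#b j. 0 < a' \<and> 0 < d' \<and> 0 \<le> e' \<and> a j \<le> a' \<and> a' \<le> d' \<and> d' \<le> d j) \<and>
        total_energy (b j) = e j)"

definition modified_jobs ::
  "nat \<Rightarrow> (nat \<Rightarrow> nat) \<Rightarrow> (nat \<Rightarrow> nat) \<Rightarrow> (nat \<Rightarrow> real) \<Rightarrow> (nat \<Rightarrow> demand multiset) \<Rightarrow> nat set" where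
  "modified_jobs n a d e b = {j\<in>jobs n. b j \<noteq> {#(a j, d j, e j)#}}"

definition feasible_attacks ::
  "nat \<Rightarrow> (nat \<Rightarrow> nat) \<Rightarrow> (nat \<Rightarrow> nat) \<Rightarrow> (nat \<Rightarrow> real) \<Rightarrow> real \<Rightarrow> (nat \<Rightarrow> demand multiset) set" where
  "feasible_attacks n a d e \<beta> =
     {b. valid_attack n a d e b \<and> real (card (modified_jobs n a d e b)) \<le> \<beta> * real n}"

definition attack_cost ::
  "nat \<Rightarrow> nat \<Rightarrow> (real \<Rightarrow> real) \<Rightarrow> (nat \<Rightarrow> demand multiset) \<Rightarrow> real" where
  "attack_cost T n C b = base_cost T C (\<Sum>j\<in>jobs n. b j)"

text \<open>The supremum below is over a nonempty set if \<open>0 \<le> \<beta>\<close>, and over a set that is bounded above if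
  the cost function is non-decreasing; see \<open>feasible_attacks_nonempty\<close> and \<open>bdd_above_attack_cost\<close>.\<close>

definition C2_maxmin ::
  "nat \<Rightarrow> nat \<Rightarrow> (real \<Rightarrow> real) \<Rightarrow> (nat \<Rightarrow> nat) \<Rightarrow> (nat \<Rightarrow> nat) \<Rightarrow> (nat \<Rightarrow> real) \<Rightarrow> real \<Rightarrow> real" where
  "C2_maxmin T n C a d e \<beta> = (SUP b\<in>feasible_attacks n a d e \<beta>. attack_cost T n C b)"

definition clique :: "nat \<Rightarrow> (nat \<Rightarrow> nat) \<Rightarrow> (nat \<Rightarrow> nat) \<Rightarrow> nat set \<Rightarrow> bool" where
  "clique n a d K \<longleftrightarrow>
     K \<subseteq> jobs n \<and> (\<forall>i\<in>K. \<forall>j\<in>K. job_interval a d i \<inter> job_interval a d j \<noteq> {})"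

definition clique_partition ::
  "nat \<Rightarrow> (nat \<Rightarrow> nat) \<Rightarrow> (nat \<Rightarrow> nat) \<Rightarrow> nat set set \<Rightarrow> bool" where
  "clique_partition n a d P \<longleftrightarrow> partition_on (jobs n) P \<and> (\<forall>K\<in>P. clique n a d K)"

definition slot_jobs :: "nat \<Rightarrow> (nat \<Rightarrow> nat) \<Rightarrow> (nat \<Rightarrow> nat) \<Rightarrow> nat \<Rightarrow> nat set" where
  "slot_jobs n a d t = {j\<in>jobs n. a j \<le> t \<and> t \<le> d j}"

definition locally_maximal ::
  "nat \<Rightarrow> nat \<Rightarrow> (nat \<Rightarrow> nat) \<Rightarrow> (nat \<Rightarrow> nat) \<Rightarrow> nat set \<Rightarrow> bool" where
  "locally_maximal T n a d K \<longleftrightarrow> clique n a d K \<and> (\<exists>t\<in>{1..T}. K = slot_jobs n a d t)"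

text \<open>A choice of modified jobs \<open>S\<close> and of slots \<open>\<tau> j\<close>, all within the budget. Jobs outside \<open>S\<close> keep
  their true deadline, but the baseline strategy serves them at their arrival slot.\<close>

definition slot_choice ::
  "nat \<Rightarrow> (nat \<Rightarrow> nat) \<Rightarrow> (nat \<Rightarrow> nat) \<Rightarrow> real \<Rightarrow> nat set \<Rightarrow> (nat \<Rightarrow> nat) \<Rightarrow> bool" where
  "slot_choice n a d \<beta> S \<tau> \<longleftrightarrow>
     S \<subseteq> jobs n \<and> real (card S) \<le> \<beta> * real n \<and>
     (\<forall>j\<in>S. \<tau> j \<in> job_interval a d j) \<and> (\<forall>j\<in>jobs n - S. \<tau> j = a j)"

definition slot_attack ::
  "(nat \<Rightarrow> nat) \<Rightarrow> (nat \<Rightarrow> nat) \<Rightarrow> (nat \<Rightarrow> real) \<Rightarrow> nat set \<Rightarrow> (nat \<Rightarrow> nat) \<Rightarrow> nat \<Rightarrow> demand multiset" where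
  "slot_attack a d e S \<tau> j =
     (if j \<in> S then {#(\<tau> j, \<tau> j, e j)#} else {#(a j, d j, e j)#})"

definition slot_partition :: "nat \<Rightarrow> nat \<Rightarrow> (nat \<Rightarrow> nat) \<Rightarrow> nat set set" where
  "slot_partition T n \<tau> = (\<lambda>t. {j\<in>jobs n. \<tau> j = t}) ` {1..T} - {{}}"

definition optimal_clique_partition ::
  "nat \<Rightarrow> nat \<Rightarrow> (real \<Rightarrow> real) \<Rightarrow> (nat \<Rightarrow> nat) \<Rightarrow> (nat \<Rightarrow> nat) \<Rightarrow> (nat \<Rightarrow> real) \<Rightarrow> real
    \<Rightarrow> nat set set \<Rightarrow> bool" where
  "optimal_clique_partition T n C a d e \<beta> P \<longleftrightarrow>
     clique_partition n a d P \<and>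
     (\<exists>S \<tau>. slot_choice n a d \<beta> S \<tau> \<and> P = slot_partition T n \<tau> \<and>
        attack_cost T n C (slot_attack a d e S \<tau>) = C2_maxmin T n C a d e \<beta>)"

lemma feasible_attacks_nonempty:
  assumes "\<forall>j\<in>jobs n. 1 \<le> a j \<and> a j \<le> d j \<and> 0 < e j" and "0 \<le> \<beta>"
  shows "feasible_attacks n a d e \<beta> \<noteq> {}"
proof -
  have "(\<lambda>j. {#(a j, d j, e j)#}) \<in> feasible_attacks n a d e \<beta>"
    using assms by (force simp: feasible_attacks_def valid_attack_def modified_jobs_def total_energy_def)
  then show ?thesis by blast
qed

lemma total_energy_plus: "total_energy (D + E) = total_energy D + total_energy E"
  by (simp add: total_energy_def)

lemma total_energy_sum: "finite A \<Longrightarrow> total_energy (\<Sum>j\<in>A. b j) = (\<Sum>j\<in>A. total_energy (b j))"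
  by (induction A rule: finite_induct) (simp_all add: total_energy_plus, simp add: total_energy_def)

lemma total_energy_nonneg: "(\<forall>(a', d', e')\<in>#D. 0 \<le> e') \<Longrightarrow> 0 \<le> total_energy D"
  by (induction D) (auto simp: total_energy_def)

lemma bdd_above_attack_cost:
  assumes mono: "mono_on {0..} C"
  shows "bdd_above (attack_cost T n C ` feasible_attacks n a d e \<beta>)"
proof (rule bdd_aboveI2)
  fix b assume "b \<in> feasible_attacks n a d e \<beta>"
  then have v: "valid_attack n a d e b" by (simp add: feasible_attacks_def)
  define D where "D = (\<Sum>j\<in>jobs n. b j)"
  have fin: "finite (jobs n)" by (simp add: jobs_def)
  have nn: "\<forall>(a', d', e')\<in>#D. 0 \<le> e'"
    using v fin by (fastforce simp: D_def valid_attack_def set_mset_sum)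
  have tot: "total_energy D = (\<Sum>j\<in>jobs n. e j)"
    using v fin by (simp add: D_def total_energy_sum valid_attack_def)
  have "C (total_energy (filter_mset (\<lambda>(a', d', e'). a' = t) D)) \<le> C (\<Sum>j\<in>jobs n. e j)" for t
  proof -
    let ?P = "\<lambda>(a' :: nat, d' :: nat, e' :: real). a' = t"
    have "D = filter_mset ?P D + filter_mset (\<lambda>x. \<not> ?P x) D" by (rule multiset_partition)
    then have "total_energy D = total_energy (filter_mset ?P D) + total_energy (filter_mset (\<lambda>x. \<not> ?P x) D)"
      using total_energy_plus by metis
    moreover have "0 \<le> total_energy (filter_mset ?P D)" "0 \<le> total_energy (filter_mset (\<lambda>x. \<not> ?P x) D)"
      using nn by (auto intro!: total_energy_nonneg)
    ultimately show ?thesis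
      using mono tot by (intro mono_onD[OF mono]) auto
  qed
  then show "attack_cost T n C b \<le> (\<Sum>t\<in>{0..T}. C (\<Sum>j\<in>jobs n. e j))"
    unfolding attack_cost_def base_cost_def D_def[symmetric] by (intro sum_mono)
qed

end

theory Submission imports Defs begin

text \<open>
  By convexity, spreading a modified job over several slots is never better than serving it in one
  well-chosen slot, so an optimal attack is given by a choice of slots. Among the optimal choices
  take one whose fullest slot \<open>t\<close> is as full as possible, and suppose that a job \<open>j\<close> available at
  \<open>t\<close> sits in another, non-singleton clique, at slot \<open>u\<close>. If \<open>j\<close> is modified, moving it to \<open>t\<close>
  costs no budget and, by convexity, does not lower the cost. If \<open>j\<close> is unmodified, then \<open>u\<close> is its
  arrival slot, so all other members of its clique arrive strictly before \<open>u\<close> and are modified.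
  Moving \<open>j\<close> to \<open>t\<close>, and the other members to the arrival slot of the last arriving one \<open>i\<close>, keeps
  the budget (\<open>i\<close> is restored while \<open>j\<close> is modified) and again does not lower the cost. Either way
  slot \<open>t\<close> becomes fuller, a contradiction.
\<close>

section \<open>Convexity: spreading two loads apart and rounding to single slots\<close>

text \<open>Both \<open>p\<close> and \<open>q\<close> lie between \<open>u\<close> and
  \<open>v\<close>, and the equal sums give them mirrored weights \<open>l\<close> and
  \<open>1 - l\<close>. Adding the two convexity inequalities therefore leaves \<open>f u\<close>
  and \<open>f v\<close> with total weight 1 each.\<close>

lemma convex_on_spread:
  fixes f :: "real \<Rightarrow> real"
  assumes "convex_on {0..} f" "0 \<le> u" "u \<le> p" "u \<le> q" "p + q = u + v"
  shows "f p + f q \<le> f u + f v"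
proof (cases "u = v")
  case True
  then have "p = u" "q = u" using assms by auto
  then show ?thesis using True by simp
next
  case False
  with assms have uv: "u < v" by auto
  define l where "l = (p - u) / (v - u)"
  have l: "0 \<le> l" "l \<le> 1" using assms uv by (auto simp: l_def field_simps)
  have lv: "l * (v - u) = p - u" using uv by (simp add: l_def)
  have p: "p = (1 - l) * u + l * v" and q: "q = l * u + (1 - l) * v"
    using lv assms(5) by (auto simp: algebra_simps)
  have "f p \<le> (1 - l) * f u + l * f v"
    using convex_onD[OF assms(1), of l u v] l assms uv by (simp add: p)
  moreover have "f q \<le> l * f u + (1 - l) * f v"
    using convex_onD[OF assms(1), of "1 - l" u v] l assms uv by (simp add: q)
  ultimately show ?thesis by (simp add: algebra_simps)
qed

text \<open>Each exchange used later alters the loads of exactly two slots; this reduces the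
  comparison of total costs to those two.\<close>

lemma sum_le_change_two:
  fixes f g :: "'a \<Rightarrow> real"
  assumes "finite U" "p \<in> U" "q \<in> U" "p \<noteq> q"
    and "\<And>r. r \<in> U \<Longrightarrow> r \<noteq> p \<Longrightarrow> r \<noteq> q \<Longrightarrow> g r = f r"
    and "f p + f q \<le> g p + g q"
  shows "sum f U \<le> sum g U"
proof -
  have split: "sum h U = h p + h q + sum h (U - {p, q})" for h :: "'a \<Rightarrow> real"
    using sum.subset_diff[of "{p, q}" U h] assms(1-4) by simp
  have "sum g (U - {p, q}) = sum f (U - {p, q})"
    using assms(5) by (intro sum.cong) auto
  then show ?thesis using assms(6) split[of f] split[of g] by simp
qed

text \<open>The distribution \<open>w\<close> is a convex combination of the distributions concentrated in one slot.\<close>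

lemma exists_single_slot:
  fixes f :: "real \<Rightarrow> real" and w r :: "'a \<Rightarrow> real"
  assumes f: "convex_on {0..} f" and U: "finite U"
    and w: "\<And>t. t \<in> U \<Longrightarrow> 0 \<le> w t" and wsum: "sum w U = m" and m: "0 < m"
    and r: "\<And>t. t \<in> U \<Longrightarrow> 0 \<le> r t"
  shows "\<exists>t\<in>U. 0 < w t \<and>
    (\<Sum>s\<in>U. f (r s + w s)) \<le> (\<Sum>s\<in>U. f (r s + (if t = s then m else 0)))"
proof (rule ccontr)
  define F where "F t = (\<Sum>s\<in>U. f (r s + (if t = s then m else 0)))" for t
  define A where "A = (\<Sum>s\<in>U. f (r s + w s))"
  assume "\<not> ?thesis"
  then have less: "F t < A" if "t \<in> U" "0 < w t" for t
    using that by (force simp: F_def A_def not_le)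
  have psum: "(\<Sum>t\<in>U. w t / m) = 1"
    using wsum m by (simp flip: sum_divide_distrib)
  \<comment> \<open>Jensen's inequality in the fixed slot \<open>s\<close>: with weights
    \<open>w t / m\<close>, the load \<open>r s + w s\<close> is the average of the loads that arise
    at \<open>s\<close> when all of \<open>m\<close> goes to \<open>t\<close>.\<close>
  have "f (r s + w s) \<le> (\<Sum>t\<in>U. w t / m * f (r s + (if t = s then m else 0)))" if s: "s \<in> U" for s
  proof -
    have "(\<Sum>t\<in>U. w t / m * (r s + (if t = s then m else 0)))
      = (\<Sum>t\<in>U. w t / m) * r s + (\<Sum>t\<in>U. if t = s then w t else 0)"
      unfolding sum_distrib_right sum.distrib[symmetric] using m by (intro sum.cong) (auto simp: algebra_simps)
    also have "\<dots> = r s + w s" using psum s U by simp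
    finally have eq: "(\<Sum>t\<in>U. (w t / m) *\<^sub>R (r s + (if t = s then m else 0))) = r s + w s" by simp
    have "f (\<Sum>t\<in>U. (w t / m) *\<^sub>R (r s + (if t = s then m else 0)))
      \<le> (\<Sum>t\<in>U. w t / m * f (r s + (if t = s then m else 0)))"
      using U s psum w r m by (intro convex_on_sum[OF _ _ f]) (auto intro: add_nonneg_nonneg)
    then show ?thesis using eq by simp
  qed
  then have "A \<le> (\<Sum>s\<in>U. \<Sum>t\<in>U. w t / m * f (r s + (if t = s then m else 0)))"
    unfolding A_def by (rule sum_mono)
  also have "\<dots> = (\<Sum>t\<in>U. w t / m * F t)"
    unfolding F_def sum_distrib_left by (rule sum.swap)
  \<comment> \<open>Slots of weight zero contribute 0 on both sides. Strictness comes from a slot of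
    positive weight, which exists because the weights sum to \<open>m > 0\<close>.\<close>
  also have "\<dots> < (\<Sum>t\<in>U. w t / m * A)"
  proof (rule sum_strict_mono_ex1[OF U])
    show "\<forall>t\<in>U. w t / m * F t \<le> w t / m * A"
    proof
      fix t assume t: "t \<in> U"
      show "w t / m * F t \<le> w t / m * A"
        using less[OF t] w[OF t] m by (cases "w t = 0") (auto intro!: divide_right_mono mult_left_mono)
    qed
    obtain t where t: "t \<in> U" "0 < w t"
      using wsum m w by (metis less_le not_less sum_nonpos)
    then have "w t / m * F t < w t / m * A" using less[OF t] m by (intro mult_strict_left_mono) auto
    then show "\<exists>t\<in>U. w t / m * F t < w t / m * A" using t by blast
  qed
  also have "\<dots> = A" using psum by (subst sum_distrib_right[symmetric]) simp
  finally show False by simp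
qed

text \<open>The jobs of \<open>S\<close> are concentrated one after the other, all remaining jobs
  being a fixed background load for \<open>exists_single_slot\<close>. Positivity of
  \<open>w j (\<tau> j)\<close> is kept because it later shows that the chosen slot lies in the job
  interval.\<close>

lemma exists_slot_rounding:
  fixes f :: "real \<Rightarrow> real" and w :: "'j \<Rightarrow> 'a \<Rightarrow> real"
  assumes f: "convex_on {0..} f" and U: "finite U" and J: "finite J"
    and w: "\<And>j t. j \<in> J \<Longrightarrow> t \<in> U \<Longrightarrow> 0 \<le> w j t"
    and wsum: "\<And>j. j \<in> J \<Longrightarrow> sum (w j) U = e j" and e: "\<And>j. j \<in> J \<Longrightarrow> 0 < e j"
    and "finite S" "S \<subseteq> J"
  shows "\<exists>\<tau>. (\<forall>j\<in>S. \<tau> j \<in> U \<and> 0 < w j (\<tau> j)) \<and>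
    (\<Sum>s\<in>U. f (\<Sum>j\<in>J. w j s)) \<le>
    (\<Sum>s\<in>U. f (\<Sum>j\<in>J. if j \<in> S then if \<tau> j = s then e j else 0 else w j s))"
  using \<open>finite S\<close> \<open>S \<subseteq> J\<close>
proof (induction S rule: finite_induct)
  case empty
  then show ?case by simp
next
  case (insert k S)
  define v where "v \<tau> S j s = (if j \<in> S then if \<tau> j = s then e j else 0 else w j s)" for \<tau> S j s
  obtain \<tau> where \<tau>: "\<forall>j\<in>S. \<tau> j \<in> U \<and> 0 < w j (\<tau> j)"
    and le: "(\<Sum>s\<in>U. f (\<Sum>j\<in>J. w j s)) \<le> (\<Sum>s\<in>U. f (\<Sum>j\<in>J. v \<tau> S j s))"
    using insert by (auto simp: v_def)
  have k: "k \<in> J" "k \<notin> S" using insert by auto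
  \<comment> \<open>The background load seen by \<open>k\<close>: jobs of \<open>S\<close> are
    already rounded, the others still spread.\<close>
  define r where "r s = (\<Sum>j\<in>J - {k}. v \<tau> S j s)" for s
  have r0: "0 \<le> r s" if "s \<in> U" for s
    using that w e by (auto simp: r_def v_def less_imp_le split: if_splits intro!: sum_nonneg)
  obtain t where t: "t \<in> U" "0 < w k t" and
    le2: "(\<Sum>s\<in>U. f (r s + w k s)) \<le> (\<Sum>s\<in>U. f (r s + (if t = s then e k else 0)))"
    using exists_single_slot[OF f U, of "w k" "e k" r] w[OF k(1)] wsum[OF k(1)] e[OF k(1)] r0 by blast
  have e1: "(\<Sum>j\<in>J. v \<tau> S j s) = r s + w k s" for s
    using J k by (simp add: r_def v_def sum.remove)
  have e2: "(\<Sum>j\<in>J. v (\<tau>(k := t)) (insert k S) j s) = r s + (if t = s then e k else 0)" for s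
  proof -
    have "r s = (\<Sum>j\<in>J - {k}. v (\<tau>(k := t)) (insert k S) j s)"
      unfolding r_def by (intro sum.cong) (auto simp: v_def)
    moreover have "v (\<tau>(k := t)) (insert k S) k s = (if t = s then e k else 0)"
      by (simp add: v_def)
    ultimately show ?thesis
      using sum.remove[OF J k(1), of "\<lambda>j. v (\<tau>(k := t)) (insert k S) j s"] by simp
  qed
  have "(\<Sum>s\<in>U. f (\<Sum>j\<in>J. w j s)) \<le> (\<Sum>s\<in>U. f (\<Sum>j\<in>J. v (\<tau>(k := t)) (insert k S) j s))"
    using le le2 unfolding e1 e2 by (rule order_trans)
  moreover have "\<forall>j\<in>insert k S. (\<tau>(k := t)) j \<in> U \<and> 0 < w j ((\<tau>(k := t)) j)"
    using \<tau> t by auto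
  ultimately show ?case unfolding v_def by blast
qed

section \<open>Energy of an attack per arrival slot\<close>

definition slot_energy :: "demand multiset \<Rightarrow> nat \<Rightarrow> real" where
  "slot_energy D t = total_energy (filter_mset (\<lambda>(a', d', e'). a' = t) D)"

lemma slot_energy_empty [simp]: "slot_energy {#} t = 0"
  by (simp add: slot_energy_def total_energy_def)

lemma slot_energy_add_mset [simp]:
  "slot_energy (add_mset (a', d', e') D) t = (if a' = t then e' else 0) + slot_energy D t"
  by (simp add: slot_energy_def total_energy_def)

lemma slot_energy_plus: "slot_energy (D + E) t = slot_energy D t + slot_energy E t"
  by (simp add: slot_energy_def total_energy_plus)

lemma slot_energy_sum: "finite A \<Longrightarrow> slot_energy (\<Sum>j\<in>A. b j) t = (\<Sum>j\<in>A. slot_energy (b j) t)"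
  by (induction A rule: finite_induct) (simp_all add: slot_energy_plus)

lemma slot_energy_nonneg: "\<forall>(a', d', e')\<in>#D. 0 \<le> e' \<Longrightarrow> 0 \<le> slot_energy D t"
  unfolding slot_energy_def by (rule total_energy_nonneg) auto

lemma slot_energy_pos_imp: "0 < slot_energy D t \<Longrightarrow> \<exists>d' e'. (t, d', e') \<in># D"
  by (induction D; force split: if_splits)

lemma sum_slot_energy:
  assumes "finite U" "\<forall>(a', d', e')\<in>#D. a' \<in> U"
  shows "sum (slot_energy D) U = total_energy D"
  using assms(2)
  by (induction D) (auto simp: total_energy_def sum.distrib assms(1))

lemma attack_cost_slot_energy:
  "attack_cost T n C b = (\<Sum>t\<in>{0..T}. C (\<Sum>j\<in>jobs n. slot_energy (b j) t))"
proof -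
  have "finite (jobs n)" by (simp add: jobs_def)
  then show ?thesis
    by (simp add: attack_cost_def base_cost_def flip: slot_energy_def slot_energy_sum)
qed

section \<open>Loads and costs of assignments of jobs to slots\<close>

definition slot_load :: "nat \<Rightarrow> (nat \<Rightarrow> real) \<Rightarrow> (nat \<Rightarrow> nat) \<Rightarrow> nat \<Rightarrow> real" where
  "slot_load n e \<tau> t = (\<Sum>j\<in>jobs n. if \<tau> j = t then e j else 0)"

definition slot_cost :: "nat \<Rightarrow> nat \<Rightarrow> (real \<Rightarrow> real) \<Rightarrow> (nat \<Rightarrow> real) \<Rightarrow> (nat \<Rightarrow> nat) \<Rightarrow> real" where
  "slot_cost T n C e \<tau> = (\<Sum>t\<in>{0..T}. C (slot_load n e \<tau> t))"

lemma finite_jobs [simp]: "finite (jobs n)"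
  by (simp add: jobs_def)

lemma slot_load_cong:
  "(\<And>j. j \<in> jobs n \<Longrightarrow> \<tau> j = \<sigma> j) \<Longrightarrow> slot_load n e \<tau> = slot_load n e \<sigma>"
  by (auto simp: slot_load_def fun_eq_iff intro!: sum.cong)

lemma slot_cost_cong:
  "(\<And>j. j \<in> jobs n \<Longrightarrow> \<tau> j = \<sigma> j) \<Longrightarrow> slot_cost T n C e \<tau> = slot_cost T n C e \<sigma>"
  unfolding slot_cost_def using slot_load_cong[of n \<tau> \<sigma> e] by simp

lemma slot_load_upd:
  assumes "j \<in> jobs n"
  shows "slot_load n e (\<tau>(j := t)) r =
    slot_load n e \<tau> r - (if \<tau> j = r then e j else 0) + (if t = r then e j else 0)"
proof -
  have "(\<Sum>i\<in>jobs n - {j}. if (\<tau>(j := t)) i = r then e i else 0)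
    = (\<Sum>i\<in>jobs n - {j}. if \<tau> i = r then e i else 0)"
    by (intro sum.cong) auto
  then show ?thesis
    unfolding slot_load_def
    using sum.remove[OF finite_jobs assms, of "\<lambda>i. if \<tau> i = r then e i else 0"]
      sum.remove[OF finite_jobs assms, of "\<lambda>i. if (\<tau>(j := t)) i = r then e i else 0"]
    by simp
qed

lemma slot_load_merge:
  assumes "u \<noteq> s"
  shows "slot_load n e (\<lambda>i. if \<tau> i = u then s else \<tau> i) r =
    (if r = u then 0 else if r = s then slot_load n e \<tau> s + slot_load n e \<tau> u else slot_load n e \<tau> r)"
  using assms by (auto simp: slot_load_def simp flip: sum.distrib intro!: sum.neutral sum.cong)

text \<open>An unmodified job has \<open>\<tau> j = a j\<close>, so in either branch of
  \<open>slot_attack\<close> all of \<open>e j\<close> arrives at \<open>\<tau> j\<close>. The cost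
  thus depends on \<open>\<tau>\<close> alone, while \<open>S\<close> only accounts for the
  budget.\<close>

lemma slot_cost_slot_attack:
  assumes "slot_choice n a d \<beta> S \<tau>"
  shows "attack_cost T n C (slot_attack a d e S \<tau>) = slot_cost T n C e \<tau>"
proof -
  have "slot_energy (slot_attack a d e S \<tau> j) t = (if \<tau> j = t then e j else 0)"
    if "j \<in> jobs n" for j t
    using assms that by (auto simp: slot_choice_def slot_attack_def)
  then show ?thesis
    by (simp add: attack_cost_slot_energy slot_cost_def slot_load_def)
qed

section \<open>Reduction of arbitrary attacks to slot choices\<close>

locale attacker =
  fixes T n :: nat and a d :: "nat \<Rightarrow> nat" and e :: "nat \<Rightarrow> real"
    and C :: "real \<Rightarrow> real" and \<beta> :: real
  assumes n: "n \<ge> 1"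
    and demand: "\<And>j. j \<in> jobs n \<Longrightarrow> 1 \<le> a j \<and> a j \<le> d j \<and> d j \<le> T \<and> 0 < e j"
    and inj: "inj_on a (jobs n)"
    and conv: "convex_on {0..} C"
    and \<beta>: "0 \<le> \<beta>"
begin

abbreviation "choice \<equiv> slot_choice n a d \<beta>"
abbreviation "load \<equiv> slot_load n e"
abbreviation "cost \<equiv> slot_cost T n C e"

lemma choice_slot:
  assumes "choice S \<tau>" "j \<in> jobs n"
  shows "a j \<le> \<tau> j" "\<tau> j \<le> d j" "1 \<le> \<tau> j" "\<tau> j \<le> T"
proof -
  show "a j \<le> \<tau> j" "\<tau> j \<le> d j"
    using assms demand[of j] by (cases "j \<in> S"; auto simp: slot_choice_def job_interval_def)+
  then show "1 \<le> \<tau> j" "\<tau> j \<le> T" using demand[OF assms(2)] by auto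
qed

lemma load_nonneg: "0 \<le> load \<tau> t"
  using demand by (auto simp: slot_load_def less_imp_le intro!: sum_nonneg)

lemma load_ge: "j \<in> jobs n \<Longrightarrow> e j \<le> load \<tau> (\<tau> j)"
  using member_le_sum[of j "jobs n" "\<lambda>i. if \<tau> i = \<tau> j then e i else 0"] demand
  by (auto simp: slot_load_def less_imp_le)

lemma slot_attack_feasible:
  assumes "choice S \<tau>"
  shows "slot_attack a d e S \<tau> \<in> feasible_attacks n a d e \<beta>"
proof -
  have "valid_attack n a d e (slot_attack a d e S \<tau>)"
    using choice_slot[OF assms] demand
    by (fastforce simp: valid_attack_def slot_attack_def total_energy_def)
  \<comment> \<open>The inclusion can be strict: if \<open>a j = d j\<close>, forging
    \<open>j\<close> to its only slot changes nothing.\<close>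
  moreover have "modified_jobs n a d e (slot_attack a d e S \<tau>) \<subseteq> S"
    by (auto simp: modified_jobs_def slot_attack_def)
  then have "card (modified_jobs n a d e (slot_attack a d e S \<tau>)) \<le> card S"
    using assms by (intro card_mono) (auto simp: slot_choice_def intro: finite_subset)
  ultimately show ?thesis using assms by (auto simp: feasible_attacks_def slot_choice_def)
qed

text \<open>Rounding is applied to exactly the jobs that \<open>b\<close> modifies, so the budget
  carries over; the unmodified jobs already sit in one slot, their arrival.\<close>

lemma exists_choice_ge:
  assumes "b \<in> feasible_attacks n a d e \<beta>"
  shows "\<exists>S \<tau>. choice S \<tau> \<and> attack_cost T n C b \<le> cost \<tau>"
proof -
  define S where "S = modified_jobs n a d e b"
  have valid: "valid_attack n a d e b" and bud: "real (card S) \<le> \<beta> * real n"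
    using assms by (auto simp: feasible_attacks_def S_def)
  have S: "S \<subseteq> jobs n" by (auto simp: S_def modified_jobs_def)
  have unmod: "b j = {#(a j, d j, e j)#}" if "j \<in> jobs n - S" for j
    using that by (auto simp: S_def modified_jobs_def)
  have sub: "\<forall>(a', d', e')\<in>#b j. 0 \<le> e' \<and> a j \<le> a' \<and> a' \<le> d j \<and> a' \<in> {0..T}"
    and tot: "total_energy (b j) = e j" if "j \<in> jobs n" for j
    using valid that demand[OF that] by (fastforce simp: valid_attack_def)+
  have "\<exists>\<tau>. (\<forall>j\<in>S. \<tau> j \<in> {0..T} \<and> 0 < slot_energy (b j) (\<tau> j)) \<and>
    (\<Sum>s\<in>{0..T}. C (\<Sum>j\<in>jobs n. slot_energy (b j) s)) \<le>
    (\<Sum>s\<in>{0..T}. C (\<Sum>j\<in>jobs n. if j \<in> S then if \<tau> j = s then e j else 0 else slot_energy (b j) s))"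
  proof (rule exists_slot_rounding[OF conv])
    show "0 \<le> slot_energy (b j) t" if "j \<in> jobs n" for j t
      using sub[OF that] by (intro slot_energy_nonneg) auto
    show "sum (slot_energy (b j)) {0..T} = e j" if "j \<in> jobs n" for j
      using sub[OF that] tot[OF that] sum_slot_energy[of "{0..T}" "b j"] by auto
  qed (use S demand in \<open>auto intro: finite_subset\<close>)
  then obtain \<tau> where \<tau>: "\<forall>j\<in>S. \<tau> j \<in> {0..T} \<and> 0 < slot_energy (b j) (\<tau> j)"
    and le: "(\<Sum>s\<in>{0..T}. C (\<Sum>j\<in>jobs n. slot_energy (b j) s)) \<le>
      (\<Sum>s\<in>{0..T}. C (\<Sum>j\<in>jobs n. if j \<in> S then if \<tau> j = s then e j else 0 else slot_energy (b j) s))"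
    by blast
  define \<sigma> where "\<sigma> j = (if j \<in> S then \<tau> j else a j)" for j
  \<comment> \<open>Positive energy at \<open>\<tau> j\<close> means that some subjob of
    \<open>j\<close> arrives there, and subjobs arrive within the job interval.\<close>
  have "\<tau> j \<in> job_interval a d j" if "j \<in> S" for j
    using slot_energy_pos_imp[of "b j" "\<tau> j"] \<tau> sub[of j] that S by (force simp: job_interval_def)
  then have "choice S \<sigma>" using S bud by (auto simp: slot_choice_def \<sigma>_def)
  moreover have "(\<Sum>j\<in>jobs n. if j \<in> S then if \<tau> j = s then e j else 0 else slot_energy (b j) s) = load \<sigma> s" for s
    unfolding slot_load_def by (intro sum.cong) (auto simp: \<sigma>_def unmod)
  then have "attack_cost T n C b \<le> cost \<sigma>"
    using le by (simp add: attack_cost_slot_energy slot_cost_def)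
  ultimately show ?thesis by blast
qed

text \<open>The supremum over all attacks is a maximum over choices: the slot attack of the best
  choice attains it, and every attack is dominated by a choice.\<close>

lemma C2_maxmin_eq:
  assumes "choice S \<tau>" and max: "\<And>S' \<tau>'. choice S' \<tau>' \<Longrightarrow> cost \<tau>' \<le> cost \<tau>"
  shows "C2_maxmin T n C a d e \<beta> = cost \<tau>"
  unfolding C2_maxmin_def
proof (rule cSup_eq_maximum)
  show "cost \<tau> \<in> attack_cost T n C ` feasible_attacks n a d e \<beta>"
    using slot_attack_feasible[OF assms(1)] slot_cost_slot_attack[OF assms(1)] by (metis image_eqI)
  show "x \<le> cost \<tau>" if "x \<in> attack_cost T n C ` feasible_attacks n a d e \<beta>" for x
    using that exists_choice_ge max by fastforce
qed

section \<open>Slot partitions as clique partitions\<close>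

lemma slot_partition_member:
  assumes "choice S \<tau>" "j \<in> jobs n"
  shows "{i \<in> jobs n. \<tau> i = \<tau> j} \<in> slot_partition T n \<tau>"
  using assms choice_slot[OF assms] by (auto simp: slot_partition_def)

lemma clique_partition_slot_partition:
  assumes "choice S \<tau>"
  shows "clique_partition n a d (slot_partition T n \<tau>)"
  unfolding clique_partition_def
proof
  show "partition_on (jobs n) (slot_partition T n \<tau>)"
  proof (rule partition_onI)
    show "\<Union> (slot_partition T n \<tau>) = jobs n"
    proof
      show "\<Union> (slot_partition T n \<tau>) \<subseteq> jobs n" by (auto simp: slot_partition_def)
      show "jobs n \<subseteq> \<Union> (slot_partition T n \<tau>)"
        using slot_partition_member[OF assms] by blast
    qed
  qed (auto simp: slot_partition_def disjnt_def)
  show "\<forall>K\<in>slot_partition T n \<tau>. clique n a d K"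
  proof
    fix K assume "K \<in> slot_partition T n \<tau>"
    then obtain t where K: "K = {j \<in> jobs n. \<tau> j = t}" by (auto simp: slot_partition_def)
    have "t \<in> job_interval a d j" if "j \<in> K" for j
      using that choice_slot[OF assms, of j] by (auto simp: K job_interval_def)
    then show "clique n a d K" unfolding clique_def K by blast
  qed
qed

section \<open>A fullest optimal choice and the exchange argument\<close>

text \<open>Two successive maximisations over finite sets: first of the cost, then, among the
  optimal choices paired with a slot, of the load.\<close>

lemma exists_fullest_optimal:
  obtains S \<tau> t where "choice S \<tau>" "\<And>S' \<tau>'. choice S' \<tau>' \<Longrightarrow> cost \<tau>' \<le> cost \<tau>"
    "t \<in> {1..T}"
    "\<And>S' \<tau>' t'. choice S' \<tau>' \<Longrightarrow> cost \<tau> \<le> cost \<tau>' \<Longrightarrow> t' \<in> {1..T} \<Longrightarrow> load \<tau>' t' \<le> load \<tau> t"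
proof -
  \<comment> \<open>Fixing \<open>\<tau>\<close> outside \<open>jobs n\<close> leaves finitely many
    choices. Restricting a choice to \<open>jobs n\<close> changes neither its cost nor its
    loads.\<close>
  define X where "X = {(S, \<tau>). choice S \<tau> \<and> \<tau> \<in> extensional (jobs n)}"
  have "X \<subseteq> Pow (jobs n) \<times> (jobs n \<rightarrow>\<^sub>E {1..T})"
    using choice_slot unfolding X_def PiE_def Pi_def slot_choice_def[of n a d \<beta>] by auto
  moreover have "finite (Pow (jobs n) \<times> (jobs n \<rightarrow>\<^sub>E {1..T}))" by (auto intro!: finite_PiE)
  ultimately have finX: "finite X" by (rule finite_subset)
  have restr: "(S, restrict \<tau> (jobs n)) \<in> X" if "choice S \<tau>" for S \<tau>
    using that by (auto simp: X_def slot_choice_def subset_iff)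
  have restr_cost: "cost (restrict \<tau> (jobs n)) = cost \<tau>"
    and restr_load: "load (restrict \<tau> (jobs n)) = load \<tau>" for \<tau>
    by (rule slot_cost_cong slot_load_cong; simp)+
  have "choice {} a" using \<beta> by (simp add: slot_choice_def)
  then have neX: "X \<noteq> {}" using restr by blast
  define M where "M = Max ((\<lambda>(S, \<tau>). cost \<tau>) ` X)"
  have M: "cost \<tau> \<le> M" if "choice S \<tau>" for S \<tau>
    using restr[OF that] finX restr_cost[of \<tau>] unfolding M_def by (force intro!: Max_ge)
  define Q where "Q = {(S, \<tau>). (S, \<tau>) \<in> X \<and> cost \<tau> = M} \<times> {1..T}"
  have finQ: "finite Q" unfolding Q_def by (intro finite_cartesian_product finite_subset[OF _ finX]) auto
  have "M \<in> (\<lambda>(S, \<tau>). cost \<tau>) ` X" unfolding M_def using finX neX by (intro Max_in) auto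
  moreover have "1 \<in> {1..T}" using demand[of 1] n by (auto simp: jobs_def)
  ultimately have neQ: "Q \<noteq> {}" by (auto simp: Q_def)
  define L where "L = Max ((\<lambda>((S, \<tau>), t). load \<tau> t) ` Q)"
  have "L \<in> (\<lambda>((S, \<tau>), t). load \<tau> t) ` Q" unfolding L_def using finQ neQ by (intro Max_in) auto
  then obtain S \<tau> t where *: "((S, \<tau>), t) \<in> Q" "load \<tau> t = L" by auto
  show thesis
  proof (rule that)
    show "choice S \<tau>" "t \<in> {1..T}" using * by (auto simp: Q_def X_def)
    show "cost \<tau>' \<le> cost \<tau>" if "choice S' \<tau>'" for S' \<tau>'
      using M[OF that] * by (auto simp: Q_def)
    fix S' \<tau>' t' assume c: "choice S' \<tau>'" "cost \<tau> \<le> cost \<tau>'" "t' \<in> {1..T}"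
    then have "cost \<tau>' = M" using M[OF c(1)] * by (auto simp: Q_def)
    then have "((S', restrict \<tau>' (jobs n)), t') \<in> Q"
      using restr[OF c(1)] restr_cost[of \<tau>'] c(3) by (auto simp: Q_def)
    then have "load (restrict \<tau>' (jobs n)) t' \<le> L"
      unfolding L_def using finQ by (force intro!: Max_ge)
    then show "load \<tau>' t' \<le> load \<tau> t" using * restr_load by simp
  qed
qed

text \<open>The target is at least as loaded as the source, so shifting \<open>e j\<close> spreads
  the two loads further apart. The source contains \<open>j\<close>, hence its load stays
  nonnegative.\<close>

lemma cost_move_le:
  assumes "choice S \<tau>" "j \<in> jobs n" "t \<in> {1..T}" "t \<noteq> \<tau> j" "load \<tau> (\<tau> j) \<le> load \<tau> t"
  shows "cost \<tau> \<le> cost (\<tau>(j := t))"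
  unfolding slot_cost_def
proof (rule sum_le_change_two[of _ "\<tau> j" t])
  have "C (load \<tau> (\<tau> j)) + C (load \<tau> t) \<le> C (load \<tau> (\<tau> j) - e j) + C (load \<tau> t + e j)"
    using load_ge[OF assms(2), of \<tau>] demand[OF assms(2)] assms(5)
    by (intro convex_on_spread[OF conv]) auto
  then show "C (load \<tau> (\<tau> j)) + C (load \<tau> t)
      \<le> C (load (\<tau>(j := t)) (\<tau> j)) + C (load (\<tau>(j := t)) t)"
    using assms by (simp add: slot_load_upd)
qed (use assms choice_slot[OF assms(1,2)] in \<open>auto simp: slot_load_upd\<close>)

text \<open>Emptying a slot is the extreme spread: the two loads become 0 and their sum, whichever
  of them was larger.\<close>

lemma cost_merge_le:
  assumes "u \<in> {0..T}" "s \<in> {0..T}" "u \<noteq> s"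
  shows "cost \<tau> \<le> cost (\<lambda>i. if \<tau> i = u then s else \<tau> i)"
  unfolding slot_cost_def
proof (rule sum_le_change_two[of _ u s])
  have "C (load \<tau> u) + C (load \<tau> s) \<le> C 0 + C (load \<tau> s + load \<tau> u)"
    using load_nonneg by (intro convex_on_spread[OF conv]) auto
  then show "C (load \<tau> u) + C (load \<tau> s) \<le>
      C (load (\<lambda>i. if \<tau> i = u then s else \<tau> i) u) + C (load (\<lambda>i. if \<tau> i = u then s else \<tau> i) s)"
    using assms by (simp add: slot_load_merge)
qed (use assms in \<open>auto simp: slot_load_merge\<close>)

text \<open>The second member \<open>k\<close> of the clique of \<open>j\<close> ensures that, when
  \<open>j\<close> is still unmodified, some other member is there whose share of the budget can be
  handed to \<open>j\<close>.\<close>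

lemma exists_fuller_choice:
  assumes ch: "choice S \<tau>" and j: "j \<in> jobs n" and t: "a j \<le> t" "t \<le> d j" "t \<noteq> \<tau> j"
    and max: "load \<tau> (\<tau> j) \<le> load \<tau> t"
    and k: "k \<in> jobs n" "k \<noteq> j" "\<tau> k = \<tau> j"
  shows "\<exists>S' \<tau>'. choice S' \<tau>' \<and> cost \<tau> \<le> cost \<tau>' \<and> load \<tau> t < load \<tau>' t"
proof -
  define u where "u = \<tau> j"
  have tT: "t \<in> {1..T}" using t demand[OF j] by auto
  have move: "cost \<tau> \<le> cost (\<tau>(j := t))" using cost_move_le[OF ch j tT t(3) max] .
  have fuller: "load \<tau> t < load (\<tau>(j := t)) t"
    using t j demand[OF j] by (simp add: slot_load_upd)
  show ?thesis
  proof (cases "j \<in> S")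
    case True
    then have "choice S (\<tau>(j := t))" using ch t by (auto simp: slot_choice_def job_interval_def)
    then show ?thesis using move fuller by blast
  next
    case False
    then have u: "u = a j" using ch j by (auto simp: slot_choice_def u_def)
    define I where "I = {i \<in> jobs n. i \<noteq> j \<and> \<tau> i = u}"
    have IS: "i \<in> S" and Ia: "a i < u" and Id: "u \<le> d i" if "i \<in> I" for i
    proof -
      have i: "i \<in> jobs n" "i \<noteq> j" "\<tau> i = u" using that by (auto simp: I_def)
      \<comment> \<open>Slot \<open>u\<close> is already the arrival slot of \<open>j\<close>, and
        arrivals are distinct. So \<open>i\<close> was moved to \<open>u\<close> from an earlier
        arrival.\<close>
      have "a i \<noteq> u" using inj i j u by (auto dest: inj_onD)
      then show "i \<in> S" "a i < u" "u \<le> d i"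
        using choice_slot[OF ch i(1)] i ch unfolding slot_choice_def by force+
    qed
    have I: "finite I" "I \<noteq> {}" using k by (auto simp: I_def u_def)
    \<comment> \<open>The latest arrival is a slot that suits all of \<open>I\<close>: every member
      has arrived by \<open>s\<close>, and \<open>s < u\<close> lies before every deadline.\<close>
    define s where "s = Max (a ` I)"
    have "s \<in> a ` I" unfolding s_def using I by (intro Max_in) auto
    then obtain i where i: "i \<in> I" "s = a i" by auto
    have s_ge: "a i' \<le> s" if "i' \<in> I" for i' using that I by (simp add: s_def)
    have su: "s < u" using i Ia by auto
    have ut: "u < t" using t u by (auto simp: u_def)
    \<comment> \<open>Written as a move followed by a merge, so that the two cost lemmas chain.
      Since \<open>t\<close> differs from \<open>u\<close> and \<open>s\<close>, the merge neither
      takes \<open>j\<close> along nor alters the load at \<open>t\<close>.\<close>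
    define \<tau>' where "\<tau>' = (\<lambda>m. if (\<tau>(j := t)) m = u then s else (\<tau>(j := t)) m)"
    \<comment> \<open>Job \<open>i\<close> now sits at its own arrival slot \<open>s\<close> and
      counts as unmodified, which pays for \<open>j\<close>.\<close>
    define S' where "S' = insert j (S - {i})"
    have finS: "finite S" using ch by (auto simp: slot_choice_def intro: finite_subset)
    have \<tau>': "\<tau>' m = (if m = j then t else if m \<in> I then s else \<tau> m)" if "m \<in> jobs n" for m
      using that ut by (auto simp: \<tau>'_def I_def)
    have "card S' = card S"
      using False finS IS[OF i(1)] card_Suc_Diff1[of S i] by (simp add: S'_def)
    moreover have "S' \<subseteq> jobs n" using ch j by (auto simp: S'_def slot_choice_def)
    moreover have "\<tau>' m \<in> job_interval a d m" if "m \<in> S'" for m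
    proof -
      have m: "m \<in> jobs n" using that \<open>S' \<subseteq> jobs n\<close> by auto
      show ?thesis
        using \<tau>'[OF m] t s_ge[of m] Id[of m] su choice_slot[OF ch m]
        by (auto simp: job_interval_def)
    qed
    moreover have "\<tau>' m = a m" if "m \<in> jobs n - S'" for m
      using that \<tau>'[of m] i IS[of m] ch by (auto simp: S'_def slot_choice_def)
    ultimately have "choice S' \<tau>'"
      using ch by (auto simp: slot_choice_def)
    moreover have "cost (\<tau>(j := t)) \<le> cost \<tau>'"
      unfolding \<tau>'_def using su ut tT by (intro cost_merge_le) auto
    moreover have "load \<tau>' t = load (\<tau>(j := t)) t"
      unfolding \<tau>'_def using su ut by (subst slot_load_merge) auto
    ultimately show ?thesis using move fuller by (metis order_trans)
  qed
qed

theorem exists_optimal_clique_partition: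
  "\<exists>P. optimal_clique_partition T n C a d e \<beta> P \<and>
    (\<exists>K\<in>P. \<exists>t\<in>{1..T}. K \<subseteq> slot_jobs n a d t \<and> (\<forall>j\<in>slot_jobs n a d t - K. {j} \<in> P))"
proof -
  obtain S \<tau> t where ch: "choice S \<tau>"
    and opt: "\<And>S' \<tau>'. choice S' \<tau>' \<Longrightarrow> cost \<tau>' \<le> cost \<tau>"
    and t: "t \<in> {1..T}"
    and full: "\<And>S' \<tau>' t'. choice S' \<tau>' \<Longrightarrow> cost \<tau> \<le> cost \<tau>' \<Longrightarrow> t' \<in> {1..T} \<Longrightarrow> load \<tau>' t' \<le> load \<tau> t"
    using exists_fullest_optimal by metis
  define P where "P = slot_partition T n \<tau>"
  define K where "K = {j \<in> jobs n. \<tau> j = t}"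
  have slotT: "\<tau> j \<in> {1..T}" if "j \<in> jobs n" for j using choice_slot[OF ch that] by auto
  have C2: "C2_maxmin T n C a d e \<beta> = cost \<tau>" using C2_maxmin_eq[OF ch] opt by blast
  have "optimal_clique_partition T n C a d e \<beta> P"
    unfolding optimal_clique_partition_def P_def
    using clique_partition_slot_partition[OF ch] ch C2 slot_cost_slot_attack[OF ch] by metis
  \<comment> \<open>Only nonemptiness of \<open>K\<close> is at stake: slot \<open>t\<close> is at
    least as loaded as the slot of job 1, whose load is positive.\<close>
  moreover have "K \<in> P"
  proof -
    have 1: "1 \<in> jobs n" using n by (simp add: jobs_def)
    have "0 < load \<tau> (\<tau> 1)" using load_ge[OF 1, of \<tau>] demand[OF 1] by auto
    also have "\<dots> \<le> load \<tau> t" using full[OF ch _ slotT[OF 1]] by auto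
    finally have "load \<tau> t \<noteq> 0" by simp
    then obtain j where "j \<in> jobs n" "(if \<tau> j = t then e j else 0) \<noteq> 0"
      unfolding slot_load_def by (rule sum.not_neutral_contains_not_neutral)
    then have "j \<in> jobs n" "\<tau> j = t" by (auto split: if_splits)
    then show ?thesis using slot_partition_member[OF ch] by (auto simp: K_def P_def)
  qed
  moreover have "K \<subseteq> slot_jobs n a d t"
    using choice_slot[OF ch] by (auto simp: K_def slot_jobs_def)
  moreover have "{j} \<in> P" if "j \<in> slot_jobs n a d t - K" for j
  proof -
    have j: "j \<in> jobs n" "a j \<le> t" "t \<le> d j" "t \<noteq> \<tau> j"
      using that by (auto simp: slot_jobs_def K_def)
    have "load \<tau> (\<tau> j) \<le> load \<tau> t" using full[OF ch _ slotT[OF j(1)]] by auto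
    \<comment> \<open>A companion \<open>k\<close> of \<open>j\<close> would give a choice that
      costs at least as much and is strictly fuller at \<open>t\<close>, against
      \<open>full\<close>.\<close>
    then have "k = j" if "k \<in> jobs n" "\<tau> k = \<tau> j" for k
      using exists_fuller_choice[OF ch j, of k] that full t by fastforce
    then have "{i \<in> jobs n. \<tau> i = \<tau> j} = {j}" using j by auto
    then show ?thesis using slot_partition_member[OF ch j(1)] by (simp add: P_def)
  qed
  ultimately show ?thesis using t by blast
qed

end

theorem theorem6:
  fixes T n :: nat and a d :: "nat \<Rightarrow> nat" and e :: "nat \<Rightarrow> real"
    and C :: "real \<Rightarrow> real" and \<beta> :: real
  assumes "n \<ge> 1"
    and "\<forall>j\<in>jobs n. a j \<in> {1..T} \<and> d j \<in> {1..T} \<and> a j \<le> d j \<and> e j > 0"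
    and "\<forall>x\<ge>0. C x \<ge> 0"
    and "inj_on a (jobs n)"
    and "mono_on {0..} C"
    and "convex_on {0..} C"
    and "\<beta> \<in> {0..1}"
  shows "\<exists>P. optimal_clique_partition T n C a d e \<beta> P \<and>
    (\<exists>K\<in>P. locally_maximal T n a d K \<or>
      (\<exists>t\<in>{1..T}. K \<subseteq> slot_jobs n a d t \<and> (\<forall>j\<in>slot_jobs n a d t - K. {j} \<in> P)))"
proof -
  interpret attacker T n a d e C \<beta>
    using assms by unfold_locales auto
  \<comment> \<open>The second alternative is the one established; it includes the locally maximal
    case, where no job has to be added to \<open>K\<close>.\<close>
  show ?thesis using exists_optimal_clique_partition by blast
qed

end
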